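(* Let $\mathrm{V}$ be a finite vertex set, let $\mathfrak{G}$ be the class of all acyclic directed mixed graphs (ADMGs) over $\mathrm{V}$, and let $\mathcal{L}=(\mathfrak{G},\preceq)$ be the poset with $\mathcal{G}_1\preceq\mathcal{G}_2$ if and only if $\mathcal{M}^{\mathrm{c}}_{\mathrm{ADMG}}(\mathcal{G}_1)\subseteq\mathcal{M}^{\mathrm{c}}_{\mathrm{ADMG}}(\mathcal{G}_2)$. Then: 1. The least element of $\mathcal{L}$ is the empty graph. There is no greatest element when $|\mathrm{V}|>1$. 2. $\mathcal{L}$ is graded with $\mathrm{rank}(\mathcal{G})$ equal to the total number of edges of $\mathcal{G}$. 3. $\mathcal{G}_1\lessdot\mathcal{G}_2$ if and only if $\mathcal{G}_1$ is a subgraph of $\mathcal{G}_2$ with exactly one fewer edge. 4. $\mathcal{L}$ is a meet semi-lattice. 5. $\mathcal{L}$ is lower semimodular.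
   Context: An ADMG $\mathcal{G}=(\mathrm{V},\mathrm{E}^{\leftrightarrow},\mathrm{E}^{\to})$ has a set $\mathrm{E}^{\leftrightarrow}$ of bidirected edges (unordered pairs of distinct vertices) and a set $\mathrm{E}^{\to}$ of directed edges (ordered pairs of distinct vertices) with no directed cycle; a pair may carry both a bidirected and a directed edge. The total number of edges is $|\mathrm{E}^{\leftrightarrow}|+|\mathrm{E}^{\to}|$. A subgraph here is over the same vertices with subsets of both edge sets. Causal model. For each $v\in\mathrm{V}$ let $\mathcal{X}_v$ be a state space, infinite or finite with at least two elements; $\mathcal{X}_{\mathrm{I}}=\prod_{v\in\mathrm{I}}\mathcal{X}_v$ for $\mathrm{I}\subseteq\mathrm{V}$, and $\mathcal{X}=\mathcal{X}_{\mathrm{V}}$ is equipped with a suitable product $\sigma$-algebra. The potential outcome schedule is the stochastic process $X(\cdot)=(X_v(x_{\mathrm{I}}):v\in\mathrm{V},\mathrm{I}\subseteq\mathrm{V},x_{\mathrm{I}}\in\mathcal{X}_{\mathrm{I}})$, where the $\mathcal{X}_v$-valued $X_v(x_{\mathrm{I}})$ is the potential outcome of variable $v$ under the intervention imposing $x_{\mathrm{I}}$ on $X_{\mathrm{I}}$. The space in which $X(\cdot)$ takes values is assumed to carry a suitable $\sigma$-algebra; $P$ denotes the law of $X(\cdot)$ and is assumed to admit the regular conditional probability distributions used below. Write $X_{\mathrm{J}}(x_{\mathrm{I}})=(X_v(x_{\mathrm{I}}))_{v\in\mathrm{J}}$ and $X(x_{\mathrm{I}})=X_{\mathrm{V}}(x_{\mathrm{I}})$.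 The ground causal model $\mathcal{M}^{\mathrm{c}}$ is the set of laws $P$ satisfying consistency: for all disjoint $\mathrm{I},\mathrm{I}'\subseteq\mathrm{V}$ and each $x\in\mathcal{X}$, $P\big(X(x_{\mathrm{I}},x_{\mathrm{I}'})=X(x_{\mathrm{I}})\mid X_{\mathrm{I}'}(x_{\mathrm{I}})=x_{\mathrm{I}'}\big)=1$. With $\mathrm{Pa}(v)=\{w:w\to v\}$, $\mathcal{M}^{\mathrm{c}}_{\mathrm{ADMG}}(\mathcal{G})$ is the set of $P\in\mathcal{M}^{\mathrm{c}}$ such that: (i) for every $v\in\mathrm{V}$, $\mathrm{I}\subseteq\mathrm{V}$ and $x\in\mathcal{X}$, $P\big\{X_v(x_{\mathrm{I}})=X_v\big(x_{\mathrm{Pa}(v)\cap\mathrm{I}},X_{\mathrm{Pa}(v)\setminus\mathrm{I}}(x_{\mathrm{I}})\big)\big\}=1$; (ii) for all disjoint $\mathrm{A},\mathrm{B}\subset\mathrm{V}$ with no bidirected edge between a vertex of $\mathrm{A}$ and a vertex of $\mathrm{B}$, $X_{\mathrm{A}}(x)$ and $X_{\mathrm{B}}(x)$ are independent under $P$ for every $x\in\mathcal{X}$. Poset terms: $x\lessdot y$ ($y$ covers $x$) if $x\prec y$ with nothing strictly between. A poset is connected if any two elements are joined by a sequence whose consecutive elements are in a covering relation. A connected poset is graded with rank function $\mathrm{rank}:\mathfrak{G}\to\mathbb{N}$ if $x\lessdot y$ implies $\mathrm{rank}(y)=\mathrm{rank}(x)+1$, and $\mathrm{rank}(x)=0$ for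 some minimal $x$. Meet semi-lattice: every two elements have a greatest lower bound. Lower semimodular: whenever $z$ covers $x$ and $y$ with $x\ne y$, some $w$ is covered by both $x$ and $y$.
   Formalization: Laws P in the ground causal model must have separable paths (a countable set of intervention levels decides whether two potential outcomes of a variable agree; automatic for countable state spaces); without it part 3 fails for uncountable ones. Singletons are assumed measurable. *)

theory Defs
  imports "HOL-Probability.Probability" "HOL-Algebra.Lattice"
begin

section \<open>Acyclic directed mixed graphs\<close>

record 'v mixed_graph =
  bidirected :: "'v set set"
  directed :: "('v \<times> 'v) set"

definition admgs :: "'v set \<Rightarrow> 'v mixed_graph set" where
  "admgs V = {G.
     bidirected G \<subseteq> {{u, v} | u v. u \<in> V \<and> v \<in> V \<and> u \<noteq> v} \<and>
     directed G \<subseteq> {(u, v). u \<in> V \<and> v \<in> V \<and> u \<noteq> v} \<and>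
     acyclic (directed G)}"

definition empty_admg :: "'v mixed_graph" where
  "empty_admg = \<lparr>bidirected = {}, directed = {}\<rparr>"

definition num_edges :: "'v mixed_graph \<Rightarrow> nat" where
  "num_edges G = card (bidirected G) + card (directed G)"

definition subgraph :: "'v mixed_graph \<Rightarrow> 'v mixed_graph \<Rightarrow> bool" where
  "subgraph G H \<longleftrightarrow> bidirected G \<subseteq> bidirected H \<and> directed G \<subseteq> directed H"

definition parents :: "'v mixed_graph \<Rightarrow> 'v \<Rightarrow> 'v set" where
  "parents G v = {w. (w, v) \<in> directed G}"


section \<open>Potential outcome schedules\<close>

text \<open>
  The state space of \<open>v\<close> is the measurable space \<open>M v\<close>. A realisation \<open>s\<close> of the potential outcome
  schedule maps \<open>(v, I, x\<^sub>I)\<close> to the value of \<open>X\<^sub>v(x\<^sub>I)\<close>, where \<open>x\<^sub>I\<close> is extensional on \<open>I\<close>. The case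
  \<open>v \<in> I\<close> is allowed, and \<open>X\<^sub>v(x\<^sub>I)\<close> is then \<^emph>\<open>not\<close> forced to equal \<open>x\<^sub>v\<close>: it is the value that \<open>v\<close>
  would have taken, had it not itself been overridden.
\<close>

type_synonym ('v, 'a) schedule = "'v \<times> 'v set \<times> ('v \<Rightarrow> 'a) \<Rightarrow> 'a"

definition states :: "('v \<Rightarrow> 'a measure) \<Rightarrow> 'v set \<Rightarrow> ('v \<Rightarrow> 'a) set" where
  "states M I = (\<Pi>\<^sub>E v\<in>I. space (M v))"

definition schedule_index :: "('v \<Rightarrow> 'a measure) \<Rightarrow> 'v set \<Rightarrow> ('v \<times> 'v set \<times> ('v \<Rightarrow> 'a)) set" where
  "schedule_index M V = {(v, I, xI). v \<in> V \<and> I \<subseteq> V \<and> xI \<in> states M I}"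

definition schedule_PiM :: "('v \<Rightarrow> 'a measure) \<Rightarrow> 'v set \<Rightarrow> ('v, 'a) schedule measure" where
  "schedule_PiM M V = PiM (schedule_index M V) (\<lambda>i. M (fst i))"

text \<open>
  The measurable spaces admitted for the schedule: every potential outcome is a random variable,
  and single schedules are events. If \<open>\<X>\<close> is countable the product sigma-algebra itself is
  admitted (lemma \<open>schedule_space_PiM_countable\<close>).
\<close>

definition schedule_space ::
  "('v \<Rightarrow> 'a measure) \<Rightarrow> 'v set \<Rightarrow> ('v, 'a) schedule measure \<Rightarrow> bool" where
  "schedule_space M V W \<longleftrightarrow>
     space W = space (schedule_PiM M V) \<and>
     sets (schedule_PiM M V) \<subseteq> sets W \<and>
     (\<forall>s\<in>space W. {s} \<in> sets W)"

text \<open>\<open>pot s v I x\<close> is \<open>X\<^sub>v(x\<^sub>I)\<close> and \<open>pots s J I x\<close> is \<open>X\<^sub>J(x\<^sub>I)\<close>; both use \<open>x\<close> only on \<open>I\<close>.\<close>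

definition pot :: "('v, 'a) schedule \<Rightarrow> 'v \<Rightarrow> 'v set \<Rightarrow> ('v \<Rightarrow> 'a) \<Rightarrow> 'a" where
  "pot s v I x = s (v, I, restrict x I)"

definition pots :: "('v, 'a) schedule \<Rightarrow> 'v set \<Rightarrow> 'v set \<Rightarrow> ('v \<Rightarrow> 'a) \<Rightarrow> ('v \<Rightarrow> 'a)" where
  "pots s J I x = (\<lambda>v\<in>J. pot s v I x)"


section \<open>Laws of the schedule\<close>

text \<open>\<open>\<kappa>\<close> is a regular conditional distribution, under \<open>P\<close>, of the sample point given \<open>Y\<close> with values
  in \<open>N\<close>.\<close>

definition regular_cond_distr ::
  "'s measure \<Rightarrow> 'b measure \<Rightarrow> ('s \<Rightarrow> 'b) \<Rightarrow> ('b \<Rightarrow> 's measure) \<Rightarrow> bool" where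
  "regular_cond_distr P N Y \<kappa> \<longleftrightarrow>
     \<kappa> \<in> measurable N (prob_algebra P) \<and>
     (\<forall>A\<in>sets P. \<forall>B\<in>sets N.
        emeasure P (A \<inter> (Y -` B \<inter> space P)) = (\<integral>\<^sup>+y\<in>B. emeasure (\<kappa> y) A \<partial>distr P N Y))"

text \<open>
  The regularity asked of the sample paths: equality of two potential outcomes of a variable,
  as functions of the intervention levels, is decided on a countable set. This is a version of
  separability of a stochastic process, and it holds for every law if \<open>\<X>\<close> is countable (lemma
  \<open>separable_paths_countable\<close>). For uncountable \<open>\<X>\<close> it is what allows random values to be
  substituted into an identity that holds almost surely at each fixed intervention level; without
  it, adding an edge to a graph need not enlarge the model.
\<close>

definition separable_paths ::
  "('v \<Rightarrow> 'a measure) \<Rightarrow> 'v set \<Rightarrow> ('v, 'a) schedule measure \<Rightarrow> bool" where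
  "separable_paths M V P \<longleftrightarrow>
     (\<exists>D\<subseteq>states M V. countable D \<and>
        (AE s in P. \<forall>v\<in>V. \<forall>I\<subseteq>V. \<forall>J\<subseteq>V.
           (\<forall>x\<in>D. pot s v I x = pot s v J x) \<longrightarrow> (\<forall>x\<in>states M V. pot s v I x = pot s v J x)))"

definition schedule_laws ::
  "('v \<Rightarrow> 'a measure) \<Rightarrow> 'v set \<Rightarrow> ('v, 'a) schedule measure \<Rightarrow> ('v, 'a) schedule measure set" where
  "schedule_laws M V W = {P \<in> space (prob_algebra W). separable_paths M V P}"

text \<open>
  In the definition of consistency, \<open>\<kappa> x\<^sub>I\<close> is a version of the conditional law given
  \<open>X\<^bsub>I'\<^esub>(x\<^sub>I)\<close>, as a kernel in the conditioning value; the requirement is imposed on it at every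
  point.
\<close>

definition consistent ::
  "('v \<Rightarrow> 'a measure) \<Rightarrow> 'v set \<Rightarrow> ('v, 'a) schedule measure \<Rightarrow> bool" where
  "consistent M V P \<longleftrightarrow>
     (\<forall>I I'. I \<subseteq> V \<and> I' \<subseteq> V \<and> I \<inter> I' = {} \<longrightarrow>
        (\<exists>\<kappa>. \<forall>x\<in>states M V.
           regular_cond_distr P (PiM I' M) (\<lambda>s. pots s I' I x) (\<kappa> (restrict x I)) \<and>
           (AE s in \<kappa> (restrict x I) (restrict x I'). pots s V (I \<union> I') x = pots s V I x)))"

definition ground_model ::
  "('v \<Rightarrow> 'a measure) \<Rightarrow> 'v set \<Rightarrow> ('v, 'a) schedule measure \<Rightarrow> ('v, 'a) schedule measure set" where
  "ground_model M V W = {P \<in> schedule_laws M V W. consistent M V P}"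

text \<open>
  On the right-hand side of the first condition all parents of \<open>v\<close> are intervened on: those in \<open>I\<close>
  at the level prescribed by \<open>x\<close>, the others at their own potential outcome under \<open>x\<^sub>I\<close>.
\<close>

definition admg_model ::
  "('v \<Rightarrow> 'a measure) \<Rightarrow> 'v set \<Rightarrow> ('v, 'a) schedule measure \<Rightarrow> 'v mixed_graph \<Rightarrow>
   ('v, 'a) schedule measure set" where
  "admg_model M V W G = {P \<in> ground_model M V W.
     (\<forall>v\<in>V. \<forall>I\<subseteq>V. \<forall>x\<in>states M V.
        AE s in P. pot s v I x = pot s v (parents G v) (\<lambda>w. if w \<in> I then x w else pot s w I x)) \<and>
     (\<forall>A\<subseteq>V. \<forall>B\<subseteq>V. A \<inter> B = {} \<and> (\<forall>a\<in>A. \<forall>b\<in>B. {a, b} \<notin> bidirected G) \<longrightarrow>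
        (\<forall>x\<in>states M V.
           prob_space.indep_var P (PiM A M) (\<lambda>s. pots s A V x) (PiM B M) (\<lambda>s. pots s B V x)))}"

definition admg_order ::
  "('v \<Rightarrow> 'a measure) \<Rightarrow> 'v set \<Rightarrow> ('v, 'a) schedule measure \<Rightarrow> 'v mixed_graph gorder" where
  "admg_order M V W = \<lparr>carrier = admgs V, eq = (=),
     le = (\<lambda>G H. admg_model M V W G \<subseteq> admg_model M V W H)\<rparr>"


section \<open>Graded and lower semimodular posets\<close>

text \<open>\<open>covered L x y\<close>: \<open>x\<close> is covered by \<open>y\<close>.\<close>

definition covered :: "('b, 'c) gorder_scheme \<Rightarrow> 'b \<Rightarrow> 'b \<Rightarrow> bool" where
  "covered L x y \<longleftrightarrow> x \<in> carrier L \<and> y \<in> carrier L \<and> x \<sqsubset>\<^bsub>L\<^esub> y \<and>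
     \<not> (\<exists>z\<in>carrier L. x \<sqsubset>\<^bsub>L\<^esub> z \<and> z \<sqsubset>\<^bsub>L\<^esub> y)"

definition connected_poset :: "('b, 'c) gorder_scheme \<Rightarrow> bool" where
  "connected_poset L \<longleftrightarrow>
     (\<forall>x\<in>carrier L. \<forall>y\<in>carrier L. (\<lambda>a b. covered L a b \<or> covered L b a)\<^sup>*\<^sup>* x y)"

definition graded_by :: "('b, 'c) gorder_scheme \<Rightarrow> ('b \<Rightarrow> nat) \<Rightarrow> bool" where
  "graded_by L \<rho> \<longleftrightarrow> partial_order L \<and> connected_poset L \<and>
     (\<forall>x y. covered L x y \<longrightarrow> \<rho> y = \<rho> x + 1) \<and>
     (\<exists>x\<in>carrier L. \<not> (\<exists>y\<in>carrier L. y \<sqsubset>\<^bsub>L\<^esub> x) \<and> \<rho> x = 0)"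

definition lower_semimodular :: "('b, 'c) gorder_scheme \<Rightarrow> bool" where
  "lower_semimodular L \<longleftrightarrow>
     (\<forall>x y z. covered L x z \<and> covered L y z \<and> x \<noteq> y \<longrightarrow> (\<exists>w. covered L w x \<and> covered L w y))"


section \<open>Countable state spaces and atoms\<close>

lemma countable_states:
  assumes "finite I" "\<And>v. v \<in> I \<Longrightarrow> countable (space (M v))"
  shows "countable (states M I)"
  unfolding states_def using assms by (rule countable_PiE)

lemma schedule_space_PiM_countable:
  assumes "finite V" "\<And>v. v \<in> V \<Longrightarrow> countable (space (M v))"
    and sing: "\<And>v a. v \<in> V \<Longrightarrow> a \<in> space (M v) \<Longrightarrow> {a} \<in> sets (M v)"
  shows "schedule_space M V (schedule_PiM M V)"
proof -
  have "schedule_index M V = (SIGMA v:V. SIGMA I:Pow V. states M I)"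
    by (auto simp: schedule_index_def)
  moreover have "countable (states M I)" if "I \<subseteq> V" for I
    using that assms by (intro countable_states) (auto intro: finite_subset)
  ultimately have cnt: "countable (schedule_index M V)"
    using \<open>finite V\<close> by (auto intro!: countable_SIGMA simp: countable_finite)
  have "{s} \<in> sets (schedule_PiM M V)" if s: "s \<in> space (schedule_PiM M V)" for s
  proof -
    have sP: "s \<in> (\<Pi>\<^sub>E i\<in>schedule_index M V. space (M (fst i)))"
      using s by (simp add: schedule_PiM_def space_PiM)
    then have "{s} = (\<Pi>\<^sub>E i\<in>schedule_index M V. {s i})"
      by (auto simp: PiE_def Pi_def intro: extensionalityI)
    also have "\<dots> \<in> sets (schedule_PiM M V)"
      unfolding schedule_PiM_def
    proof (rule sets_PiM_I_countable[OF cnt])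
      fix i assume i: "i \<in> schedule_index M V"
      then show "{s i} \<in> sets (M (fst i))"
        using PiE_mem[OF sP i] sing by (auto simp: schedule_index_def)
    qed
    finally show ?thesis .
  qed
  then show ?thesis by (simp add: schedule_space_def)
qed

lemma separable_paths_countable:
  assumes "finite V" "\<And>v. v \<in> V \<Longrightarrow> countable (space (M v))"
  shows "separable_paths M V P"
  unfolding separable_paths_def
  by (rule exI[of _ "states M V"]) (auto intro: countable_states assms)

text \<open>At an atom of the conditioning variable, the kernel is elementary conditional probability.\<close>

lemma regular_cond_distr_atom:
  assumes "regular_cond_distr P N Y \<kappa>" "Y \<in> measurable P N" "{y} \<in> sets N" "A \<in> sets P"
  shows "emeasure P (A \<inter> (Y -` {y} \<inter> space P)) = emeasure (\<kappa> y) A * emeasure P (Y -` {y} \<inter> space P)"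
proof -
  have "emeasure P (A \<inter> (Y -` {y} \<inter> space P)) = (\<integral>\<^sup>+z\<in>{y}. emeasure (\<kappa> z) A \<partial>distr P N Y)"
    using assms by (auto simp: regular_cond_distr_def)
  also have "\<dots> = (\<integral>\<^sup>+z. emeasure (\<kappa> y) A * indicator {y} z \<partial>distr P N Y)"
    by (intro nn_integral_cong) (auto simp: indicator_def)
  also have "\<dots> = emeasure (\<kappa> y) A * emeasure (distr P N Y) {y}"
    using assms(3) by (subst nn_integral_cmult_indicator) auto
  finally show ?thesis using assms by (simp add: emeasure_distr)
qed

end

theory Submission
  imports Defs
begin

text \<open>
  The model of \<open>G\<close> is contained in that of \<open>H\<close> exactly if \<open>G\<close> is a subgraph of \<open>H\<close>; the rest is
  combinatorics of the edge sets, which form a family closed under subsets. If \<open>G\<close> is a subgraph of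
  \<open>H\<close>, the only point is that new parents may be intervened on without effect: \<open>X\<^sub>v\<close> under an
  intervention on the larger parent set agrees almost surely with \<open>X\<^sub>v\<close> under an intervention on
  the smaller one, simultaneously at all levels by separability, so random levels may be
  substituted. Conversely, a bidirected edge \<open>a \<leftrightarrow> b\<close> is detected by a law in which \<open>X\<^sub>a\<close> and \<open>X\<^sub>b\<close>
  copy one fair coin whatever the intervention, and a directed edge \<open>a \<rightarrow> b\<close> by a deterministic
  schedule in which only \<open>X\<^sub>b\<close> reacts, and only to interventions on \<open>a\<close>.
\<close>

section \<open>Discrete laws\<close>

text \<open>Each event of \<open>X\<close> is almost surely everything or nothing, according to
  whether its set contains \<open>c\<close>, and such events are independent of all others. This
  settles every independence requirement with a deterministic side.\<close>

lemma (in prob_space) indep_var_AE_const_left: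
  assumes X: "random_variable S X" and Y: "random_variable T Y"
    and c: "AE \<omega> in M. X \<omega> = c"
  shows "indep_var S X T Y"
proof -
  let ?E = "\<lambda>S X. {X -` A \<inter> space M |A. A \<in> sets S}"
  have "indep_set (?E S X) (?E T Y)"
  proof (rule indep_setI)
    show "?E S X \<subseteq> events" "?E T Y \<subseteq> events"
      using X Y by (auto intro: measurable_sets)
    fix a b assume "a \<in> ?E S X" "b \<in> ?E T Y"
    then obtain A where A: "a = X -` A \<inter> space M" "A \<in> sets S" and b: "b \<in> events"
      using Y by (auto intro: measurable_sets)
    have a: "a \<in> events"
      using A X by (auto intro: measurable_sets)
    show "prob (a \<inter> b) = prob a * prob b"
    proof (cases "c \<in> A")
      case True
      have "prob a = prob (space M)" "prob (a \<inter> b) = prob b"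
        using c a b True A by (auto intro!: finite_measure_eq_AE)
      then show ?thesis by (simp add: prob_space)
    next
      case False
      have "prob a = prob {}" "prob (a \<inter> b) = prob {}"
        by (rule finite_measure_eq_AE; use c a b False A in auto)+
      then show ?thesis by simp
    qed
  qed
  \<comment> \<open>The two event families are reindexed by \<open>bool\<close>, the form in which
    \<open>indep_vars_def2\<close> states independence.\<close>
  then have "indep_sets (\<lambda>i. ?E (case_bool S T i) (case_bool X Y i)) UNIV"
    unfolding indep_set_def
    by (rule indep_sets_mono_sets) (auto split: bool.splits)
  with X Y show ?thesis
    unfolding indep_var_def indep_vars_def2 by (auto split: bool.split)
qed

lemma (in prob_space) indep_var_sym:
  assumes "indep_var S X T Y"
  shows "indep_var T Y S X"
proof -
  have "random_variable S X" "random_variable T Y"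
    using assms by (rule indep_var_rv1, rule indep_var_rv2)
  moreover have "indep_set A B \<Longrightarrow> indep_set B A" for A B
    unfolding indep_sets2_eq by (metis Int_commute mult.commute)
  ultimately show ?thesis
    using assms by (auto simp: indep_var_eq)
qed

text \<open>Every map out of a pmf is measurable once it lands in \<open>space W\<close>, so the law
  lives on the full sigma-algebra of \<open>W\<close>, whatever that is.\<close>

definition discrete_law :: "'s measure \<Rightarrow> 'b pmf \<Rightarrow> ('b \<Rightarrow> 's) \<Rightarrow> 's measure" where
  "discrete_law W p g = distr (measure_pmf p) W g"

lemma sets_discrete_law [simp, measurable_cong]: "sets (discrete_law W p g) = sets W"
  and space_discrete_law [simp]: "space (discrete_law W p g) = space W"
  by (simp_all add: discrete_law_def)

lemma discrete_law_in_prob_algebra: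
  assumes "\<And>b. g b \<in> space W"
  shows "discrete_law W p g \<in> space (prob_algebra W)"
  using assms by (auto simp: space_prob_algebra discrete_law_def intro!: prob_space.prob_space_distr measure_pmf.prob_space_axioms)

lemma prob_space_discrete_law:
  assumes "\<And>b. g b \<in> space W"
  shows "prob_space (discrete_law W p g)"
  using discrete_law_in_prob_algebra[of g W p] assms by (simp add: space_prob_algebra)

lemma emeasure_discrete_law:
  assumes "\<And>b. g b \<in> space W" "A \<in> sets W"
  shows "emeasure (discrete_law W p g) A = emeasure (measure_pmf p) (g -` A)"
  using assms by (simp add: discrete_law_def emeasure_distr)

lemma AE_discrete_lawD:
  assumes "\<And>b. g b \<in> space W" "AE s in discrete_law W p g. Q s" "b \<in> set_pmf p"
  shows "Q (g b)"
proof -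
  have "AE b in p. Q (g b)"
    using assms(1,2) unfolding discrete_law_def by (intro AE_distrD[of g _ W]) auto
  with assms(3) show ?thesis by (simp add: AE_measure_pmf_iff)
qed

text \<open>The image of the support is countable, hence an event because singletons are, and it has
  full mass. So \<open>Q\<close> itself may be non-measurable.\<close>

lemma AE_discrete_lawI:
  assumes g: "\<And>b. g b \<in> space W" and sing: "\<And>s. s \<in> space W \<Longrightarrow> {s} \<in> sets W"
    and Q: "\<And>b. b \<in> set_pmf p \<Longrightarrow> Q (g b)"
  shows "AE s in discrete_law W p g. Q s"
proof -
  have "(\<Union>b\<in>set_pmf p. {g b}) \<in> sets W"
    using g sing by (intro sets.countable_UN' countable_set_pmf) auto
  then have [measurable]: "g ` set_pmf p \<in> sets W" by (simp add: UNION_singleton_eq_range)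
  have "AE s in discrete_law W p g. s \<in> g ` set_pmf p"
    unfolding discrete_law_def using g by (subst AE_distr_iff) (auto simp: AE_measure_pmf_iff)
  then show ?thesis by eventually_elim (use Q in auto)
qed

lemma emeasure_cond_pmf_total:
  fixes p :: "'b pmf" and h :: "'b \<Rightarrow> 'c"
  shows "emeasure (measure_pmf p) (S \<inter> h -` B) =
    (\<integral>\<^sup>+b. emeasure (measure_pmf (cond_pmf p (h -` {h b}))) S * indicator B (h b) \<partial>p)"
proof -
  \<comment> \<open>Drawing a point and then redrawing it within its fibre of \<open>h\<close> gives
    back \<open>p\<close>.\<close>
  have eq: "bind_pmf p (\<lambda>b. cond_pmf p {b'. h b = h b'}) = p"
    by (rule bind_cond_pmf_cancel) (auto simp: eq_commute intro!: arg_cong[where f="measure_pmf.prob p"])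
  have vim: "{b'. h b = h b'} = h -` {h b}" for b by auto
  have "emeasure (measure_pmf p) (S \<inter> h -` B) =
      (\<integral>\<^sup>+b. emeasure (measure_pmf (cond_pmf p (h -` {h b}))) (S \<inter> h -` B) \<partial>p)"
    by (subst eq[symmetric]) (simp add: vim)
  also have "\<dots> = (\<integral>\<^sup>+b. emeasure (measure_pmf (cond_pmf p (h -` {h b}))) S * indicator B (h b) \<partial>p)"
  proof (intro nn_integral_cong_AE, unfold AE_measure_pmf_iff, intro ballI)
    fix b assume b: "b \<in> set_pmf p"
    let ?q = "cond_pmf p (h -` {h b})"
    have "set_pmf p \<inter> h -` {h b} \<noteq> {}" using b by auto
    then have q: "set_pmf ?q \<subseteq> h -` {h b}" by (simp add: set_cond_pmf)
    show "emeasure (measure_pmf ?q) (S \<inter> h -` B) = emeasure (measure_pmf ?q) S * indicator B (h b)"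
    proof (cases "h b \<in> B")
      case True
      then have "emeasure (measure_pmf ?q) (S \<inter> h -` B) = emeasure (measure_pmf ?q) S"
        using q by (intro emeasure_eq_AE) (auto simp: AE_measure_pmf_iff dest!: subsetD)
      with True show ?thesis by simp
    next
      case False
      have "emeasure (measure_pmf ?q) (S \<inter> h -` B) = emeasure (measure_pmf ?q) {}"
        using q False by (intro emeasure_eq_AE) (auto simp: AE_measure_pmf_iff)
      with False show ?thesis by simp
    qed
  qed
  finally show ?thesis .
qed

text \<open>
  Consistency is imposed on the kernel at every conditioning value, including values outside the
  support, where elementary conditioning is undefined; there the kernel is the point mass at \<open>c\<close>.
\<close>

definition discrete_kernel ::
  "'s measure \<Rightarrow> 'b pmf \<Rightarrow> ('b \<Rightarrow> 's) \<Rightarrow> ('s \<Rightarrow> 'c) \<Rightarrow> 's \<Rightarrow> 'c \<Rightarrow> 's measure" where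
  "discrete_kernel W p g Y c y =
     (if y \<in> (\<lambda>b. Y (g b)) ` set_pmf p then discrete_law W (cond_pmf p ((\<lambda>b. Y (g b)) -` {y})) g
      else return W c)"

lemma regular_cond_distr_discrete_kernel:
  fixes p :: "'b pmf"
  assumes g: "\<And>b. g b \<in> space W" and c: "c \<in> space W"
    and Y: "Y \<in> measurable W N" and sing: "\<And>y. y \<in> space N \<Longrightarrow> {y} \<in> sets N"
  shows "regular_cond_distr (discrete_law W p g) N Y (discrete_kernel W p g Y c)"
proof -
  define h where "h = (\<lambda>b. Y (g b))"
  have hN: "h b \<in> space N" for b
    using g Y unfolding h_def by (auto dest: measurable_space)
  have alg: "prob_algebra (discrete_law W p g) = prob_algebra W"
    unfolding prob_algebra_def by (simp cong: subprob_algebra_cong)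
  have k: "discrete_kernel W p g Y c \<in> measurable N (prob_algebra W)"
  \<comment> \<open>The kernel differs from a constant one only on a countable set of measurable
    singletons.\<close>
  proof (rule measurable_discrete_difference[of "\<lambda>_. return W c" _ _ "h ` set_pmf p"])
    show "(\<lambda>_. return W c) \<in> measurable N (prob_algebra W)"
      using c by (auto simp: space_prob_algebra prob_space_return)
    show "discrete_kernel W p g Y c x \<in> space (prob_algebra W)" for x
      using g c by (auto simp: discrete_kernel_def discrete_law_in_prob_algebra space_prob_algebra prob_space_return prob_space_discrete_law)
  qed (auto simp: discrete_kernel_def h_def intro!: sing hN[unfolded h_def])
  have "emeasure (discrete_law W p g) (A \<inter> (Y -` B \<inter> space W)) =
      (\<integral>\<^sup>+y\<in>B. emeasure (discrete_kernel W p g Y c y) A \<partial>distr (discrete_law W p g) N Y)"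
    if A: "A \<in> sets W" and B: "B \<in> sets N" for A B
  proof -
    have [measurable]: "discrete_kernel W p g Y c \<in> measurable N (subprob_algebra W)"
      using k by (rule measurable_prob_algebraD)
    note [measurable] = A B Y
    have g': "g \<in> measurable (measure_pmf p) W" using g by auto
    have "emeasure (discrete_law W p g) (A \<inter> (Y -` B \<inter> space W))
        = emeasure (measure_pmf p) (g -` A \<inter> h -` B)"
      using g by (subst emeasure_discrete_law) (auto simp: h_def intro!: arg_cong[where f="emeasure (measure_pmf p)"])
    also have "\<dots> = (\<integral>\<^sup>+b. emeasure (measure_pmf (cond_pmf p (h -` {h b}))) (g -` A) * indicator B (h b) \<partial>p)"
      by (rule emeasure_cond_pmf_total)
    also have "\<dots> = (\<integral>\<^sup>+b. emeasure (discrete_kernel W p g Y c (h b)) A * indicator B (h b) \<partial>p)"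
      using g A by (intro nn_integral_cong_AE)
        (auto simp: AE_measure_pmf_iff discrete_kernel_def h_def emeasure_discrete_law)
    also have "\<dots> = (\<integral>\<^sup>+s. emeasure (discrete_kernel W p g Y c (Y s)) A * indicator B (Y s) \<partial>discrete_law W p g)"
      unfolding discrete_law_def h_def by (subst nn_integral_distr[OF g']) auto
    also have "\<dots> = (\<integral>\<^sup>+y\<in>B. emeasure (discrete_kernel W p g Y c y) A \<partial>distr (discrete_law W p g) N Y)"
      by (subst nn_integral_distr) auto
    finally show ?thesis .
  qed
  with k show ?thesis
    unfolding regular_cond_distr_def alg by simp
qed

section \<open>Inclusion of models\<close>

locale causal_setting =
  fixes V :: "'v set" and M :: "'v \<Rightarrow> 'a measure" and W :: "('v, 'a) schedule measure"
  assumes finite_V: "finite V"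
    and two_states: "v \<in> V \<Longrightarrow> infinite (space (M v)) \<or> 2 \<le> card (space (M v))"
    and singleton_sets: "v \<in> V \<Longrightarrow> a \<in> space (M v) \<Longrightarrow> {a} \<in> sets (M v)"
    and schedule_space: "schedule_space M V W"
begin

section \<open>Measurability of potential outcomes, and schedules given by formulas\<close>

lemma space_W: "space W = (\<Pi>\<^sub>E i\<in>schedule_index M V. space (M (fst i)))"
  using schedule_space by (simp add: schedule_space_def schedule_PiM_def space_PiM)

lemma singleton_W: "s \<in> space W \<Longrightarrow> {s} \<in> sets W"
  using schedule_space by (simp add: schedule_space_def)

lemma restrict_states: "x \<in> states M V \<Longrightarrow> I \<subseteq> V \<Longrightarrow> restrict x I \<in> states M I"
  by (auto simp: states_def PiE_def Pi_def)

lemma pot_in_space: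
  assumes "s \<in> space W" "v \<in> V" "I \<subseteq> V" "restrict x I \<in> states M I"
  shows "pot s v I x \<in> space (M v)"
  using assms PiE_mem[of s "schedule_index M V" "\<lambda>i. space (M (fst i))" "(v, I, restrict x I)"]
  by (auto simp: space_W pot_def schedule_index_def)

lemma pot_measurable:
  assumes "v \<in> V" "I \<subseteq> V" "x \<in> states M V"
  shows "(\<lambda>s. pot s v I x) \<in> measurable W (M v)"
proof -
  have i: "(v, I, restrict x I) \<in> schedule_index M V"
    using assms by (simp add: schedule_index_def restrict_states)
  have "(\<lambda>s. s (v, I, restrict x I)) \<in> measurable (schedule_PiM M V) (M (fst (v, I, restrict x I)))"
    unfolding schedule_PiM_def using i by (rule measurable_component_singleton)
  \<comment> \<open>\<open>W\<close> has the same points as the product space and at least its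
    events.\<close>
  then have "(\<lambda>s. s (v, I, restrict x I)) \<in> measurable W (M v)"
    using schedule_space unfolding schedule_space_def measurable_def by auto
  then show ?thesis by (simp add: pot_def)
qed

lemma pots_measurable:
  assumes "J \<subseteq> V" "I \<subseteq> V" "x \<in> states M V"
  shows "(\<lambda>s. pots s J I x) \<in> measurable W (PiM J M)"
  unfolding pots_def using assms by (intro measurable_restrict pot_measurable) auto

lemma singleton_PiM:
  assumes "J \<subseteq> V" "y \<in> space (PiM J M)"
  shows "{y} \<in> sets (PiM J M)"
proof -
  have y: "y \<in> (\<Pi>\<^sub>E v\<in>J. space (M v))"
    using assms(2) by (simp add: space_PiM)
  then have "{y} = (\<Pi>\<^sub>E v\<in>J. {y v})"
    by (auto simp: PiE_def Pi_def intro: extensionalityI)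
  also have "\<dots> \<in> sets (PiM J M)"
    using finite_subset[OF assms(1) finite_V] y assms(1)
    by (intro sets_PiM_I_finite singleton_sets) (auto simp: PiE_def Pi_def)
  finally show ?thesis .
qed

text \<open>Cut off outside \<open>schedule_index\<close>, since the points of \<open>W\<close> are
  extensional functions. \<open>F\<close> is only ever given levels that are extensional on
  \<open>I\<close>.\<close>

definition schedule_of :: "('v \<Rightarrow> 'v set \<Rightarrow> ('v \<Rightarrow> 'a) \<Rightarrow> 'a) \<Rightarrow> ('v, 'a) schedule" where
  "schedule_of F = (\<lambda>(v, I, x)\<in>schedule_index M V. F v I x)"

lemma schedule_of_in_space:
  assumes "\<And>v I x. v \<in> V \<Longrightarrow> I \<subseteq> V \<Longrightarrow> x \<in> states M I \<Longrightarrow> F v I x \<in> space (M v)"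
  shows "schedule_of F \<in> space W"
  using assms by (auto simp: space_W schedule_of_def schedule_index_def)

lemma pot_schedule_of:
  assumes "v \<in> V" "I \<subseteq> V" "restrict x I \<in> states M I"
  shows "pot (schedule_of F) v I x = F v I (restrict x I)"
  using assms by (simp add: pot_def schedule_of_def schedule_index_def)

text \<open>Reduces membership to conditions on single schedules. On the support, consistency is
  used only where \<open>X_J(x_I) = x_J\<close>; the default \<open>c\<close> serves conditioning
  values off the support, so it has to be unaffected by further interventions
  unconditionally.\<close>

lemma discrete_law_in_ground_model:
  fixes p :: "'b pmf"
  assumes g: "\<And>b. g b \<in> space W" and c: "c \<in> space W"
    and D: "D \<subseteq> states M V" "countable D"
      "\<And>b v I J. b \<in> set_pmf p \<Longrightarrow> v \<in> V \<Longrightarrow> I \<subseteq> V \<Longrightarrow> J \<subseteq> V \<Longrightarrow>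
        \<forall>x\<in>D. pot (g b) v I x = pot (g b) v J x \<Longrightarrow>
        \<forall>x\<in>states M V. pot (g b) v I x = pot (g b) v J x"
    and c_const: "\<And>I J x. I \<subseteq> V \<Longrightarrow> J \<subseteq> V \<Longrightarrow> x \<in> states M V \<Longrightarrow>
        pots c V (I \<union> J) x = pots c V I x"
    and cons: "\<And>b I J x. b \<in> set_pmf p \<Longrightarrow> I \<subseteq> V \<Longrightarrow> J \<subseteq> V \<Longrightarrow> I \<inter> J = {} \<Longrightarrow> x \<in> states M V \<Longrightarrow>
        pots (g b) J I x = restrict x J \<Longrightarrow> pots (g b) V (I \<union> J) x = pots (g b) V I x"
  shows "discrete_law W p g \<in> ground_model M V W"
proof -
  let ?P = "discrete_law W p g"
  have "separable_paths M V ?P"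
    unfolding separable_paths_def using D
    by (intro exI[of _ D] conjI AE_discrete_lawI[OF g singleton_W]) blast+
  moreover have "consistent M V ?P"
    unfolding consistent_def
  proof (intro allI impI)
    fix I J assume IJ: "I \<subseteq> V \<and> J \<subseteq> V \<and> I \<inter> J = {}"
    let ?\<kappa> = "\<lambda>z. discrete_kernel W p g (\<lambda>s. pots s J I z) c"
    have "regular_cond_distr ?P (PiM J M) (\<lambda>s. pots s J I x) (?\<kappa> (restrict x I)) \<and>
        (AE s in ?\<kappa> (restrict x I) (restrict x J). pots s V (I \<union> J) x = pots s V I x)"
      if x: "x \<in> states M V" for x
    proof
      \<comment> \<open>The conditioning variable reads \<open>x\<close> only on \<open>I\<close>,
        so the kernel depends on \<open>x\<close> through its restriction to \<open>I\<close>, as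
        consistency demands.\<close>
      have k: "?\<kappa> (restrict x I) = ?\<kappa> x"
        by (simp add: pots_def pot_def)
      show "regular_cond_distr ?P (PiM J M) (\<lambda>s. pots s J I x) (?\<kappa> (restrict x I))"
        unfolding k using IJ x
        by (intro regular_cond_distr_discrete_kernel g c pots_measurable singleton_PiM) auto
      let ?h = "\<lambda>b. pots (g b) J I x"
      show "AE s in ?\<kappa> (restrict x I) (restrict x J). pots s V (I \<union> J) x = pots s V I x"
      proof (cases "restrict x J \<in> ?h ` set_pmf p")
        case True
        then have "set_pmf p \<inter> ?h -` {restrict x J} \<noteq> {}" by fastforce
        then have q: "set_pmf (cond_pmf p (?h -` {restrict x J})) = set_pmf p \<inter> ?h -` {restrict x J}"
          by (rule set_cond_pmf)
        have "AE s in discrete_law W (cond_pmf p (?h -` {restrict x J})) g.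
            pots s V (I \<union> J) x = pots s V I x"
          using IJ x by (intro AE_discrete_lawI[OF g singleton_W]) (auto simp: q intro!: cons)
        then show ?thesis unfolding k discrete_kernel_def using True by (simp only: if_True)
      next
        case False
        \<comment> \<open>Written as a discrete law, the point mass admits
          \<open>AE_discrete_lawI\<close>, which needs no measurability of the event.\<close>
        have "return W c = discrete_law W (return_pmf ()) (\<lambda>_. c)"
          using c by (intro measure_eqI) (auto simp: emeasure_discrete_law indicator_def)
        also have "AE s in \<dots>. pots s V (I \<union> J) x = pots s V I x"
          using IJ x c by (intro AE_discrete_lawI singleton_W c_const) auto
        finally have "AE s in return W c. pots s V (I \<union> J) x = pots s V I x" .
        then show ?thesis unfolding k discrete_kernel_def using False by (simp only: if_False)
      qed
    qed
    then show "\<exists>\<kappa>. \<forall>x\<in>states M V.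
        regular_cond_distr ?P (PiM J M) (\<lambda>s. pots s J I x) (\<kappa> (restrict x I)) \<and>
        (AE s in \<kappa> (restrict x I) (restrict x J). pots s V (I \<union> J) x = pots s V I x)"
      by (intro exI[of _ ?\<kappa>]) blast
  qed
  ultimately show ?thesis
    using g by (simp add: ground_model_def schedule_laws_def discrete_law_in_prob_algebra)
qed

text \<open>Supplies the two values per vertex from which the separating laws are built.\<close>

lemma distinct_states:
  obtains d0 d1 where "d0 \<in> states M V" "d1 \<in> states M V" "\<And>v. v \<in> V \<Longrightarrow> d0 v \<noteq> d1 v"
proof -
  have "\<exists>a\<in>space (M v). \<exists>b\<in>space (M v). a \<noteq> b" if "v \<in> V" for v
  proof (rule ccontr)
    assume "\<not> ?thesis"
    then obtain a where "space (M v) \<subseteq> {a}" by blast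
    then have "finite (space (M v))" "card (space (M v)) \<le> 1"
      by (auto intro: finite_subset dest: card_mono[rotated])
    with two_states[OF that] show False by simp
  qed
  then obtain f0 f1 where "\<And>v. v \<in> V \<Longrightarrow> f0 v \<in> space (M v) \<and> f1 v \<in> space (M v) \<and> f0 v \<noteq> f1 v"
    by metis
  then show ?thesis
    by (intro that[of "restrict f0 V" "restrict f1 V"]) (auto simp: states_def)
qed

section \<open>Enlarging a graph enlarges its model\<close>

lemma parents_subset: "G \<in> admgs V \<Longrightarrow> parents G v \<subseteq> V"
  by (auto simp: admgs_def parents_def)

text \<open>Makes the random level substituted in a structural equation a legitimate state, so that
  identities valid at all states apply to it.\<close>

lemma intervened_states:
  assumes "s \<in> space W" "I \<subseteq> V" "x \<in> states M V"
  shows "(\<lambda>w\<in>V. if w \<in> I then x w else pot s w I x) \<in> states M V"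
  using assms pot_in_space[OF assms(1) _ assms(2) restrict_states[OF assms(3,2)]]
  by (auto simp: states_def)

lemma admg_model_mono:
  assumes G: "G \<in> admgs V" and H: "H \<in> admgs V" and sub: "subgraph G H"
  shows "admg_model M V W G \<subseteq> admg_model M V W H"
proof
  fix P assume P: "P \<in> admg_model M V W G"
  let ?y = "\<lambda>s I x. \<lambda>w. if w \<in> I then x w else pot s w I x"
  have ground: "P \<in> ground_model M V W"
    and struct: "\<And>v I x. v \<in> V \<Longrightarrow> I \<subseteq> V \<Longrightarrow> x \<in> states M V \<Longrightarrow>
        AE s in P. pot s v I x = pot s v (parents G v) (?y s I x)"
    using P by (auto simp: admg_model_def)
  then have P_W: "space P = space W" and sep: "separable_paths M V P"
    by (auto simp: ground_model_def schedule_laws_def space_prob_algebra dest: sets_eq_imp_space_eq)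
  have parents: "AE s in P. \<forall>x\<in>states M V. pot s v (parents H v) x = pot s v (parents G v) x"
    if v: "v \<in> V" for v
  proof -
    have GH: "parents G v \<subseteq> parents H v"
      using sub by (auto simp: parents_def subgraph_def)
    obtain D where D: "D \<subseteq> states M V" "countable D"
      and sepD: "AE s in P. \<forall>v\<in>V. \<forall>I\<subseteq>V. \<forall>J\<subseteq>V. (\<forall>x\<in>D. pot s v I x = pot s v J x) \<longrightarrow>
        (\<forall>x\<in>states M V. pot s v I x = pot s v J x)"
      using sep by (auto simp: separable_paths_def)
    have "AE s in P. pot s v (parents H v) x = pot s v (parents G v) x" if "x \<in> D" for x
    proof -
      \<comment> \<open>All \<open>G\<close>-parents are among the intervened
        \<open>H\<close>-parents, so the equation of \<open>G\<close> for this intervention is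
        evaluated at the fixed level \<open>x\<close>.\<close>
      have eq: "restrict (?y s (parents H v) x) (parents G v) = restrict x (parents G v)" for s
        by (rule ext) (use GH in \<open>auto simp: restrict_def\<close>)
      have "AE s in P. pot s v (parents H v) x = pot s v (parents G v) (?y s (parents H v) x)"
        using struct v H that D parents_subset by auto
      then show ?thesis
        unfolding pot_def[of _ _ "parents G v"] eq .
    qed
    then have "AE s in P. \<forall>x\<in>D. pot s v (parents H v) x = pot s v (parents G v) x"
      using D(2) by (simp add: AE_ball_countable)
    \<comment> \<open>Countably many null sets were united over \<open>D\<close>; separability
      extends the identity to all levels outside one null set.\<close>
    with sepD show ?thesis
      by eventually_elim (use v G H parents_subset in blast)
  qed
  have "AE s in P. pot s v I x = pot s v (parents H v) (?y s I x)"
    if v: "v \<in> V" "I \<subseteq> V" "x \<in> states M V" for v I x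
    using struct[OF v] parents[OF v(1)] AE_space
  proof eventually_elim
    case (elim s)
    \<comment> \<open>Replaces the substituted level by its restriction to \<open>V\<close>, which
      is a state.\<close>
    have "pot s v J (?y s I x) = pot s v J (restrict (?y s I x) V)" if "J \<subseteq> V" for J
      using that by (simp add: pot_def Int_absorb1)
    with elim intervened_states[of s I x] v G H show ?case
      by (auto simp: P_W parents_subset)
  qed
  moreover have "prob_space.indep_var P (PiM A M) (\<lambda>s. pots s A V x) (PiM B M) (\<lambda>s. pots s B V x)"
    if AB: "A \<subseteq> V" "B \<subseteq> V" "A \<inter> B = {} \<and> (\<forall>a\<in>A. \<forall>b\<in>B. {a, b} \<notin> bidirected H)" and x: "x \<in> states M V"
    for A B x
  proof -
    have "\<forall>a\<in>A. \<forall>b\<in>B. {a, b} \<notin> bidirected G"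
      using AB sub by (auto simp: subgraph_def)
    with P AB x show ?thesis
      unfolding admg_model_def by simp
  qed
  ultimately show "P \<in> admg_model M V W H"
    using ground unfolding admg_model_def by simp
qed

text \<open>With the edge present, of two sets without bidirected edges between them at least one
  misses both \<open>a\<close> and \<open>b\<close>, so its outcome is constant. Without it,
  \<open>{a}\<close> and \<open>{b}\<close> would have to be independent although they copy the same
  coin.\<close>

lemma bidirected_separated:
  assumes ab: "a \<in> V" "b \<in> V" "a \<noteq> b"
  obtains P where
    "\<And>G. G \<in> admgs V \<Longrightarrow> {a, b} \<in> bidirected G \<Longrightarrow> P \<in> admg_model M V W G"
    "\<And>G :: 'v mixed_graph. {a, b} \<notin> bidirected G \<Longrightarrow> P \<notin> admg_model M V W G"
proof -
  obtain d0 d1 where d: "d0 \<in> states M V" "d1 \<in> states M V" "\<And>v. v \<in> V \<Longrightarrow> d0 v \<noteq> d1 v"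
    using distinct_states by blast
  define U where "U = (\<lambda>\<beta> v. if \<beta> \<and> v \<in> {a, b} then d1 v else d0 v)"
  define g where "g = (\<lambda>\<beta>. schedule_of (\<lambda>v I x. U \<beta> v))"
  define p where "p = pmf_of_set (UNIV :: bool set)"
  define P where "P = discrete_law W p g"
  have g: "g \<beta> \<in> space W" for \<beta>
    unfolding g_def using d by (intro schedule_of_in_space) (auto simp: U_def states_def)
  have pot_g: "pot (g \<beta>) v I x = U \<beta> v" if "v \<in> V" "I \<subseteq> V" "restrict x I \<in> states M I" for \<beta> v I x
    using that by (simp add: g_def pot_schedule_of)
  have pots_g: "pots (g \<beta>) J I x = restrict (U \<beta>) J" if "J \<subseteq> V" "I \<subseteq> V" "x \<in> states M V" for \<beta> J I x
    unfolding pots_def using that by (intro restrict_ext pot_g restrict_states) auto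
  interpret P: prob_space P
    unfolding P_def using g by (rule prob_space_discrete_law)
  have ground: "P \<in> ground_model M V W"
    unfolding P_def
    \<comment> \<open>Outcomes ignore interventions altogether, so even the empty set decides
      equality of paths, and any of the schedules can be the default.\<close>
    by (rule discrete_law_in_ground_model[of g "g False" "{}"])
      (auto simp: g pots_g pot_g restrict_states)
  have meas: "(\<lambda>s. pots s A V x) \<in> measurable P (PiM A M)" if "A \<subseteq> V" "x \<in> states M V" for A x
    using pots_measurable[OF that(1) order_refl that(2)] by (simp add: P_def cong: measurable_cong_sets)
  show ?thesis
  proof (rule that)
    fix G assume G: "G \<in> admgs V" "{a, b} \<in> bidirected G"
    have "AE s in P. pot s v I x = pot s v (parents G v) (\<lambda>w. if w \<in> I then x w else pot s w I x)"
      if v: "v \<in> V" "I \<subseteq> V" "x \<in> states M V" for v I x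
      unfolding P_def
    proof (rule AE_discrete_lawI[OF g singleton_W])
      fix \<beta>
      have "restrict (\<lambda>w. if w \<in> I then x w else pot (g \<beta>) w I x) (parents G v) \<in> states M (parents G v)"
        using restrict_states[OF intervened_states[OF g v(2,3)] parents_subset[OF G(1), of v]]
          parents_subset[OF G(1), of v] by (simp add: Int_absorb1)
      then show "pot (g \<beta>) v I x = pot (g \<beta>) v (parents G v) (\<lambda>w. if w \<in> I then x w else pot (g \<beta>) w I x)"
        using v G parents_subset by (simp add: pot_g restrict_states)
    qed
    moreover have "P.indep_var (PiM A M) (\<lambda>s. pots s A V x) (PiM B M) (\<lambda>s. pots s B V x)"
      if AB: "A \<subseteq> V" "B \<subseteq> V" "A \<inter> B = {}" "\<forall>a\<in>A. \<forall>b\<in>B. {a, b} \<notin> bidirected G" and x: "x \<in> states M V"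
      for A B x
    proof -
      have const: "AE s in P. pots s C V x = restrict d0 C" if "C \<subseteq> V" "C \<inter> {a, b} = {}" for C
        unfolding P_def using that x
        by (intro AE_discrete_lawI[OF g singleton_W]) (auto simp: pots_g U_def restrict_def)
      have "{b, a} \<in> bidirected G" using G by (simp add: insert_commute)
      then consider "A \<inter> {a, b} = {}" | "B \<inter> {a, b} = {}"
        using AB G by blast
      then show ?thesis
      proof cases
        case 1
        from const[OF AB(1) 1] show ?thesis using AB x by (intro P.indep_var_AE_const_left meas)
      next
        case 2
        from const[OF AB(2) 2] show ?thesis
          using AB x by (intro P.indep_var_sym[OF P.indep_var_AE_const_left] meas)
      qed
    qed
    ultimately show "P \<in> admg_model M V W G"
      using ground by (simp add: admg_model_def)
  next
    fix G :: "'v mixed_graph" assume G: "{a, b} \<notin> bidirected G"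
    show "P \<notin> admg_model M V W G"
    proof
      assume "P \<in> admg_model M V W G"
      then have indep: "P.indep_var (PiM {a} M) (\<lambda>s. pots s {a} V d0) (PiM {b} M) (\<lambda>s. pots s {b} V d0)"
        using G ab d by (auto simp: admg_model_def)
      let ?E = "\<lambda>v. (\<lambda>s. pots s {v} V d0) -` {restrict d1 {v}} \<inter> space P"
      have E: "?E v \<in> sets W" "g -` ?E v = {True}" if "v \<in> {a, b}" for v
      proof -
        have v: "{v} \<subseteq> V" using that ab by auto
        have "{restrict d1 {v}} \<in> sets (PiM {v} M)"
          using v d by (intro singleton_PiM) (auto simp: space_PiM states_def)
        with meas[OF v d(1)] have "?E v \<in> sets P" by (rule measurable_sets)
        then show "?E v \<in> sets W" by (simp add: P_def)
        have "restrict (U \<beta>) {v} = restrict d1 {v} \<longleftrightarrow> \<beta>" for \<beta>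
          using that v d(3)[of v] by (auto simp: U_def fun_eq_iff restrict_def)
        then show "g -` ?E v = {True}"
          using v d g by (auto simp: pots_g P_def)
      qed
      have prob: "P.prob S = measure_pmf.prob p (g -` S)" if "S \<in> sets W" for S
        using g that by (simp add: measure_def P_def emeasure_discrete_law)
      have "P.prob (?E a \<inter> ?E b) =
          P.prob ((\<lambda>s. (pots s {a} V d0, pots s {b} V d0)) -` ({restrict d1 {a}} \<times> {restrict d1 {b}}) \<inter> space P)"
        by (rule arg_cong[where f=P.prob]) auto
      also have "\<dots> = P.prob (?E a) * P.prob (?E b)"
        using indep ab d by (intro P.indep_varD) (auto intro!: singleton_PiM simp: space_PiM states_def)
      finally have "P.prob (?E a \<inter> ?E b) = P.prob (?E a) * P.prob (?E b)" .
      \<comment> \<open>Both events say that the coin shows \<open>True\<close>; independence would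
        give 1/4 for the intersection.\<close>
      moreover have "P.prob (?E a \<inter> ?E b) = 1 / 2" "P.prob (?E a) = 1 / 2" "P.prob (?E b) = 1 / 2"
        using E by (auto simp: prob vimage_Int[of g "?E a" "?E b"] p_def measure_pmf_of_set)
      ultimately show False by simp
    qed
  qed
qed

text \<open>A point mass makes all independences trivial, so only the structural equations can tell
  graphs apart.\<close>

lemma directed_separated:
  assumes ab: "a \<in> V" "b \<in> V" "a \<noteq> b"
  obtains P where
    "\<And>G. G \<in> admgs V \<Longrightarrow> (a, b) \<in> directed G \<Longrightarrow> P \<in> admg_model M V W G"
    "\<And>G. G \<in> admgs V \<Longrightarrow> (a, b) \<notin> directed G \<Longrightarrow> P \<notin> admg_model M V W G"
proof -
  obtain d0 d1 where d: "d0 \<in> states M V" "d1 \<in> states M V" "\<And>v. v \<in> V \<Longrightarrow> d0 v \<noteq> d1 v"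
    using distinct_states by blast
  \<comment> \<open>\<open>a\<close> left alone takes the value \<open>d0 a\<close>, so imposing that value on it must not change \<open>b\<close>.\<close>
  define F where "F = (\<lambda>v I x. if v = b \<and> a \<in> I \<and> x a \<noteq> d0 a then d1 v else d0 v)"
  define s0 where "s0 = schedule_of F"
  define P where "P = discrete_law W (return_pmf ()) (\<lambda>_. s0)"
  \<comment> \<open>\<open>s0\<close> cannot be the kernel default: imposing a value other than
    \<open>d0 a\<close> on \<open>a\<close> changes \<open>b\<close>. A constant schedule
    can.\<close>
  define c where "c = schedule_of (\<lambda>v I x. d0 v)"
  have s0: "s0 \<in> space W" and c: "c \<in> space W"
    unfolding s0_def c_def using d by (auto intro!: schedule_of_in_space simp: F_def states_def)
  have pot_s0: "pot s0 v I x = F v I x" if "v \<in> V" "I \<subseteq> V" "restrict x I \<in> states M I" for v I x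
    using that by (simp add: s0_def pot_schedule_of F_def)
  have pot_c: "pot c v I x = d0 v" if "v \<in> V" "I \<subseteq> V" "x \<in> states M V" for v I x
    using that by (simp add: c_def pot_schedule_of restrict_states)
  have Fa: "F a I x = d0 a" for I x
    using ab by (simp add: F_def)
  have ground: "P \<in> ground_model M V W"
    unfolding P_def
  \<comment> \<open>The single level \<open>d1\<close> decides equality of paths: there
    \<open>b\<close> shows whether \<open>a\<close> is intervened on, and \<open>F\<close> depends
    on the intervention set in no other way.\<close>
  proof (rule discrete_law_in_ground_model[of "\<lambda>_. s0" c "{d1}"])
    fix v I J assume "v \<in> V" "I \<subseteq> V" "J \<subseteq> V" "\<forall>x\<in>{d1}. pot s0 v I x = pot s0 v J x"
    then show "\<forall>x\<in>states M V. pot s0 v I x = pot s0 v J x"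
      using ab d(2) d(3)[of a] d(3)[of b] by (auto simp: pot_s0 restrict_states F_def split: if_splits)
  next
    fix I J x assume *: "I \<subseteq> V" "J \<subseteq> V" "I \<inter> J = {}" "x \<in> states M V" "pots s0 J I x = restrict x J"
    \<comment> \<open>The premise of consistency forces the imposed value of \<open>a\<close> to be
      its natural one, to which \<open>b\<close> does not react.\<close>
    have "x a = d0 a" if "a \<in> J"
      using fun_cong[OF *(5), of a] that * ab by (simp add: pots_def pot_s0 restrict_states Fa)
    then have "F v (I \<union> J) x = F v I x" for v
      by (auto simp: F_def)
    with * show "pots s0 V (I \<union> J) x = pots s0 V I x"
      by (auto simp: pots_def pot_s0 restrict_states)
  qed (use s0 c d in \<open>auto simp: pots_def pot_c\<close>)
  interpret P: prob_space P
    unfolding P_def using s0 by (intro prob_space_discrete_law)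
  have AE_P: "(AE s in P. Q s) \<longleftrightarrow> Q s0" for Q
    unfolding P_def using s0 AE_discrete_lawD[of "\<lambda>_. s0" W Q "return_pmf ()" "()"]
    by (auto intro!: AE_discrete_lawI singleton_W)
  \<comment> \<open>A parent outside \<open>I\<close> enters at its own outcome. For
    \<open>a\<close> this is \<open>d0 a\<close>, which acts like no intervention, so only parents
    in \<open>I\<close> matter.\<close>
  have eq_iff: "pot s0 v (parents G v) (\<lambda>w. if w \<in> I then x w else pot s0 w I x) =
      F v (parents G v \<inter> I) x"
    if v: "v \<in> V" "I \<subseteq> V" "x \<in> states M V" and G: "G \<in> admgs V" for v I x G
  proof -
    have "restrict (\<lambda>w. if w \<in> I then x w else pot s0 w I x) (parents G v) \<in> states M (parents G v)"
      using restrict_states[OF intervened_states[OF s0 v(2,3)] parents_subset[OF G(1), of v]]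
        parents_subset[OF G(1), of v] by (simp add: Int_absorb1)
    then show ?thesis
      using v G ab parents_subset by (auto simp: pot_s0 restrict_states F_def)
  qed
  show ?thesis
  proof (rule that)
    fix G assume G: "G \<in> admgs V" "(a, b) \<in> directed G"
    have "P.indep_var (PiM A M) (\<lambda>s. pots s A V x) (PiM B M) (\<lambda>s. pots s B V x)"
      if "A \<subseteq> V" "B \<subseteq> V" "x \<in> states M V" for A B x
      using pots_measurable[of A V x] pots_measurable[of B V x] that
      by (intro P.indep_var_AE_const_left[of _ _ _ _ "pots s0 A V x"])
        (auto simp: AE_P, auto simp: P_def cong: measurable_cong_sets)
    moreover have "F v I x = F v (parents G v \<inter> I) x" for v I x
      using G by (auto simp: F_def parents_def)
    ultimately show "P \<in> admg_model M V W G"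
      using ground G by (auto simp: admg_model_def AE_P eq_iff pot_s0 restrict_states)
  next
    fix G assume G: "G \<in> admgs V" "(a, b) \<notin> directed G"
    show "P \<notin> admg_model M V W G"
    proof
      assume "P \<in> admg_model M V W G"
      \<comment> \<open>Imposing \<open>d1 a\<close> on \<open>a\<close> moves \<open>b\<close> to
        \<open>d1 b\<close>, while an equation without parent \<open>a\<close> predicts
        \<open>d0 b\<close>.\<close>
      then have "F b {a} d1 = F b (parents G b \<inter> {a}) d1"
        using ab d G eq_iff[of b "{a}" d1 G]
        by (auto simp: admg_model_def AE_P pot_s0 restrict_states)
      with ab G d(3)[of a] d(3)[of b] show False
        by (auto simp: F_def parents_def)
    qed
  qed
qed

lemma admg_model_subset_iff:
  assumes "G \<in> admgs V" "H \<in> admgs V"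
  shows "admg_model M V W G \<subseteq> admg_model M V W H \<longleftrightarrow> subgraph G H"
proof
  assume sub: "admg_model M V W G \<subseteq> admg_model M V W H"
  have "e \<in> bidirected H" if e: "e \<in> bidirected G" for e
  proof -
    have "e \<in> {{u, v} | u v. u \<in> V \<and> v \<in> V \<and> u \<noteq> v}"
      using assms e by (auto simp: admgs_def)
    then obtain a b where ab: "e = {a, b}" "a \<in> V" "b \<in> V" "a \<noteq> b" by blast
    show ?thesis
      using bidirected_separated[OF ab(2-4)] sub assms e ab(1) by (metis subsetD)
  qed
  moreover have "(a, b) \<in> directed H" if e: "(a, b) \<in> directed G" for a b
  proof -
    have ab: "a \<in> V" "b \<in> V" "a \<noteq> b"
      using assms e by (auto simp: admgs_def)
    show ?thesis
      using directed_separated[OF ab] sub assms e by (metis subsetD)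
  qed
  ultimately show "subgraph G H" by (auto simp: subgraph_def)
qed (use assms admg_model_mono in auto)

end

section \<open>Posets of finite sets closed under subsets\<close>

text \<open>In effect an abstract simplicial complex ordered by inclusion. Intersections of faces
  are faces; unions need not be, as when two acyclic graphs unite to a cycle.\<close>

locale face_poset =
  fixes L :: "'g gorder" and faces :: "'g \<Rightarrow> 'e set"
  assumes eq_L: "eq L = (=)"
    and le_iff: "x \<in> carrier L \<Longrightarrow> y \<in> carrier L \<Longrightarrow> x \<sqsubseteq>\<^bsub>L\<^esub> y \<longleftrightarrow> faces x \<subseteq> faces y"
    and faces_inj: "x \<in> carrier L \<Longrightarrow> y \<in> carrier L \<Longrightarrow> faces x = faces y \<Longrightarrow> x = y"
    and finite_faces: "x \<in> carrier L \<Longrightarrow> finite (faces x)"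
    and faces_down: "x \<in> carrier L \<Longrightarrow> E \<subseteq> faces x \<Longrightarrow> \<exists>y\<in>carrier L. faces y = E"
begin

lemma lless_iff: "x \<in> carrier L \<Longrightarrow> y \<in> carrier L \<Longrightarrow> x \<sqsubset>\<^bsub>L\<^esub> y \<longleftrightarrow> faces x \<subset> faces y"
  unfolding lless_def le_iff eq_L using faces_inj[of x y] by blast

lemma partial_order: "partial_order L"
proof
  fix x y z assume "x \<in> carrier L" "y \<in> carrier L" "z \<in> carrier L" "x \<sqsubseteq>\<^bsub>L\<^esub> y" "y \<sqsubseteq>\<^bsub>L\<^esub> z"
  then show "x \<sqsubseteq>\<^bsub>L\<^esub> z" by (auto simp: le_iff)
qed (auto simp: eq_L le_iff intro: faces_inj)

text \<open>By closure under subsets, adding one element of \<open>faces y - faces x\<close> to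
  \<open>faces x\<close> gives a face weakly below \<open>y\<close>, which a cover forces to be
  \<open>y\<close>. Conversely no cardinality fits in between.\<close>

lemma covered_iff:
  assumes x: "x \<in> carrier L" and y: "y \<in> carrier L"
  shows "covered L x y \<longleftrightarrow> faces x \<subseteq> faces y \<and> card (faces y) = card (faces x) + 1"
proof
  assume cov: "covered L x y"
  then have "faces x \<subset> faces y"
    using x y by (simp add: covered_def lless_iff)
  then obtain t where t: "t \<in> faces y - faces x" and sub: "faces x \<subseteq> faces y" by blast
  then obtain z where z: "z \<in> carrier L" "faces z = insert t (faces x)"
    using faces_down[OF y, of "insert t (faces x)"] by auto
  then have "x \<sqsubset>\<^bsub>L\<^esub> z" using x t by (auto simp: lless_iff)
  then have "\<not> z \<sqsubset>\<^bsub>L\<^esub> y" using cov z by (auto simp: covered_def)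
  then have "faces y = insert t (faces x)" using z y t sub by (auto simp: lless_iff)
  with t sub show "faces x \<subseteq> faces y \<and> card (faces y) = card (faces x) + 1"
    using finite_faces[OF x] by auto
next
  assume *: "faces x \<subseteq> faces y \<and> card (faces y) = card (faces x) + 1"
  have "\<not> (faces x \<subset> faces z \<and> faces z \<subset> faces y)" if "z \<in> carrier L" for z
    using * psubset_card_mono[of "faces z" "faces x"] psubset_card_mono[of "faces y" "faces z"]
      finite_faces[OF y] finite_faces[OF that] by linarith
  moreover have "faces x \<subset> faces y" using * by auto
  ultimately show "covered L x y"
    using x y by (auto simp: covered_def lless_iff)
qed

text \<open>Every element descends to the empty face by removing one element at a time; two such
  descents are joined at the bottom.\<close>

lemma connected_poset: "connected_poset L"
proof -
  let ?R = "\<lambda>a b. covered L a b \<or> covered L b a"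
  have sym: "?R\<^sup>*\<^sup>* x y" if "?R\<^sup>*\<^sup>* y x" for x y
    using that
  proof (induction rule: rtranclp_induct)
    case (step x z)
    then have "?R z x" by blast
    then show ?case using step.IH by (rule converse_rtranclp_into_rtranclp)
  qed simp
  have bot: "?R\<^sup>*\<^sup>* x b" if "x \<in> carrier L" "b \<in> carrier L" "faces b = {}" for x b
    using that(1)
  proof (induction "card (faces x)" arbitrary: x)
    case 0
    then have "x = b" using that finite_faces by (intro faces_inj) auto
    then show ?case by simp
  next
    case (Suc n)
    then obtain t where t: "t \<in> faces x" by fastforce
    obtain z where z: "z \<in> carrier L" "faces z = faces x - {t}"
      using faces_down[OF Suc.prems, of "faces x - {t}"] by auto
    have "card (faces z) = n" using z t Suc.hyps(2) finite_faces[OF Suc.prems] by simp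
    then have "?R\<^sup>*\<^sup>* z b" "covered L z x"
      using Suc z by (auto simp: covered_iff)
    then have "?R x z" by blast
    then show ?case using \<open>?R\<^sup>*\<^sup>* z b\<close> by (rule converse_rtranclp_into_rtranclp)
  qed
  show ?thesis
    unfolding connected_poset_def
  proof (intro ballI)
    fix x y assume xy: "x \<in> carrier L" "y \<in> carrier L"
    obtain b where b: "b \<in> carrier L" "faces b = {}"
      using faces_down[OF xy(1), of "{}"] by auto
    show "?R\<^sup>*\<^sup>* x y"
      using bot[OF xy(1) b] sym[OF bot[OF xy(2) b]] by (rule rtranclp_trans)
  qed
qed

lemma graded_by_card:
  assumes b: "b \<in> carrier L" "faces b = {}"
    and rank: "\<And>x. x \<in> carrier L \<Longrightarrow> \<rho> x = card (faces x)"
  shows "graded_by L \<rho>"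
proof -
  have "\<not> y \<sqsubset>\<^bsub>L\<^esub> b" if "y \<in> carrier L" for y
    using that b by (simp add: lless_iff)
  then have "\<exists>x\<in>carrier L. \<not> (\<exists>y\<in>carrier L. y \<sqsubset>\<^bsub>L\<^esub> x) \<and> \<rho> x = 0"
    using b rank by (intro bexI[of _ b]) auto
  moreover have "\<rho> y = \<rho> x + 1" if "covered L x y" for x y
    using that covered_iff[of x y] rank by (simp add: covered_def)
  ultimately show ?thesis
    using partial_order connected_poset by (simp add: graded_by_def)
qed

lemma meet_exists:
  assumes "x \<in> carrier L" "y \<in> carrier L"
  obtains w where "w \<in> carrier L" "faces w = faces x \<inter> faces y"
  using faces_down[OF assms(1), of "faces x \<inter> faces y"] by auto

lemma lower_semilattice: "lower_semilattice L"
proof -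
  interpret partial_order L by (rule partial_order)
  show ?thesis
  proof
    fix x y assume xy: "x \<in> carrier L" "y \<in> carrier L"
    then obtain w where "w \<in> carrier L" "faces w = faces x \<inter> faces y" by (rule meet_exists)
    moreover from this have "w \<sqsubseteq>\<^bsub>L\<^esub> x" "w \<sqsubseteq>\<^bsub>L\<^esub> y"
      using xy by (simp_all add: le_iff)
    moreover from calculation have "z \<sqsubseteq>\<^bsub>L\<^esub> w"
      if "z \<in> carrier L" "z \<sqsubseteq>\<^bsub>L\<^esub> x" "z \<sqsubseteq>\<^bsub>L\<^esub> y" for z
      using that xy by (simp add: le_iff)
    ultimately show "\<exists>s. greatest L s (Lower L {x, y})"
      using xy unfolding greatest_def Lower_def by (intro exI[of _ w]) blast
  qed
qed

text \<open>The witness is the meet. The union of two distinct faces covered by \<open>z\<close> has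
  more elements than either and no more than \<open>z\<close>, hence exactly as many as
  \<open>z\<close>; inclusion-exclusion then puts the intersection one below both.\<close>

lemma lower_semimodular: "lower_semimodular L"
  unfolding lower_semimodular_def
proof (intro allI impI)
  fix x y z assume *: "covered L x z \<and> covered L y z \<and> x \<noteq> y"
  then have c: "x \<in> carrier L" "y \<in> carrier L" "z \<in> carrier L" by (auto simp: covered_def)
  have xz: "faces x \<subseteq> faces z" "card (faces z) = card (faces x) + 1"
    and yz: "faces y \<subseteq> faces z" "card (faces z) = card (faces y) + 1"
    using * c by (auto simp: covered_iff)
  obtain w where w: "w \<in> carrier L" "faces w = faces x \<inter> faces y"
    by (rule meet_exists[OF c(1,2)])
  have fin: "finite (faces x)" "finite (faces y)" "finite (faces z)"
    using c by (auto intro: finite_faces)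
  have "\<not> faces y \<subseteq> faces x"
  proof
    assume "faces y \<subseteq> faces x"
    then have "faces y = faces x"
      using fin xz(2) yz(2) by (intro card_subset_eq) auto
    with c * show False using faces_inj[of x y] by simp
  qed
  then have "card (faces x) < card (faces x \<union> faces y)"
    using fin by (intro psubset_card_mono finite_UnI) blast+
  moreover have "card (faces x \<union> faces y) \<le> card (faces z)"
    using fin(3) xz(1) yz(1) by (intro card_mono) simp_all
  moreover have "card (faces x) + card (faces y) = card (faces x \<union> faces y) + card (faces w)"
    unfolding w(2) using fin(1,2) by (rule card_Un_Int)
  ultimately have "card (faces x) = card (faces w) + 1" "card (faces y) = card (faces w) + 1"
    using xz(2) yz(2) by linarith+
  then show "\<exists>w. covered L w x \<and> covered L w y"
    using w c by (intro exI[of _ w]) (simp add: covered_iff)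
qed

end


section \<open>The poset of causal models\<close>

text \<open>A tagged sum, so that a pair carrying both kinds of edge counts twice.\<close>

definition edges :: "'v mixed_graph \<Rightarrow> ('v set + 'v \<times> 'v) set" where
  "edges G = bidirected G <+> directed G"

lemma subgraph_iff_edges: "subgraph G H \<longleftrightarrow> edges G \<subseteq> edges H"
  by (auto simp: subgraph_def edges_def Plus_def)

lemma edges_inj:
  fixes G H :: "'v mixed_graph"
  assumes "edges G = edges H"
  shows "G = H"
  using assms subgraph_iff_edges[of G H] subgraph_iff_edges[of H G]
  by (cases G, cases H) (simp add: subgraph_def set_eq_subset)

lemma finite_edge_sets:
  assumes "finite V" "G \<in> admgs V"
  shows "finite (bidirected G)" "finite (directed G)"
proof -
  have "bidirected G \<subseteq> Pow V" "directed G \<subseteq> V \<times> V"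
    using assms(2) by (auto simp: admgs_def)
  moreover have "finite (Pow V)" "finite (V \<times> V)"
    using assms(1) by simp_all
  ultimately show "finite (bidirected G)" "finite (directed G)"
    by (blast dest: finite_subset)+
qed

lemma num_edges_eq_card: "finite V \<Longrightarrow> G \<in> admgs V \<Longrightarrow> num_edges G = card (edges G)"
  using finite_edge_sets[of V G] by (simp add: num_edges_def edges_def card_Plus)

text \<open>Deleting edges preserves acyclicity, so admissible edge sets are closed under
  subsets.\<close>

lemma edges_down:
  assumes G: "G \<in> admgs V" and E: "E \<subseteq> edges G"
  shows "\<exists>H\<in>admgs V. edges H = E"
proof
  let ?H = "\<lparr>bidirected = Inl -` E, directed = Inr -` E\<rparr>"
  show "edges ?H = E"
  proof (rule Set.set_eqI) \<comment> \<open>HOL-Algebra shadows the short name.\<close>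
    show "e \<in> edges ?H \<longleftrightarrow> e \<in> E" for e
      by (cases e) (auto simp: edges_def)
  qed
  have "Inl -` E \<subseteq> bidirected G" "Inr -` E \<subseteq> directed G"
    using E by (auto simp: edges_def Plus_def)
  then show "?H \<in> admgs V"
    using G acyclic_subset[of "directed G" "Inr -` E"] unfolding admgs_def by auto
qed

lemma single_arc_in_admgs:
  assumes "u \<in> V" "v \<in> V" "u \<noteq> v"
  shows "\<lparr>bidirected = {}, directed = {(u, v)}\<rparr> \<in> admgs V"
  using assms by (auto simp: admgs_def acyclic_def dest: tranclD tranclD2)

theorem corollary4:
  fixes V :: "'v set" and M :: "'v \<Rightarrow> 'a measure" and W :: "('v, 'a) schedule measure"
  assumes "finite V"
    and "\<And>v. v \<in> V \<Longrightarrow> infinite (space (M v)) \<or> 2 \<le> card (space (M v))"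
    and "\<And>v a. v \<in> V \<Longrightarrow> a \<in> space (M v) \<Longrightarrow> {a} \<in> sets (M v)"
    and "schedule_space M V W"
    and "L = admg_order M V W"
  shows
    "partial_order L \<and>
     least L empty_admg (carrier L) \<and>
     (1 < card V \<longrightarrow> \<not> (\<exists>G. greatest L G (carrier L))) \<and>
     graded_by L num_edges \<and>
     (\<forall>G1\<in>carrier L. \<forall>G2\<in>carrier L.
        covered L G1 G2 \<longleftrightarrow> subgraph G1 G2 \<and> num_edges G2 = num_edges G1 + 1) \<and>
     lower_semilattice L \<and>
     lower_semimodular L"
proof -
  interpret causal_setting V M W
    using assms(1-4) by unfold_locales
  have car: "carrier L = admgs V" by (simp add: assms(5) admg_order_def)
  have le: "G \<sqsubseteq>\<^bsub>L\<^esub> H \<longleftrightarrow> edges G \<subseteq> edges H" if "G \<in> admgs V" "H \<in> admgs V" for G H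
    using admg_model_subset_iff[OF that] by (simp add: assms(5) admg_order_def subgraph_iff_edges)
  have fin: "finite (edges G)" if "G \<in> admgs V" for G
    using finite_edge_sets[OF assms(1) that] by (simp add: edges_def)
  interpret face_poset L edges
    by unfold_locales
      (auto simp: car le fin edges_inj edges_down, simp add: assms(5) admg_order_def)
  have empty: "empty_admg \<in> admgs V" "edges empty_admg = {}"
    by (auto simp: admgs_def empty_admg_def edges_def acyclic_def)
  have least: "least L empty_admg (carrier L)"
    using empty by (auto simp: least_def car le)
  have no_greatest: "\<not> (\<exists>G. greatest L G (carrier L))" if "1 < card V"
  proof
    assume "\<exists>G. greatest L G (carrier L)"
    then obtain G where G: "G \<in> admgs V" "\<And>H. H \<in> admgs V \<Longrightarrow> subgraph H G"
      by (auto simp: greatest_def car le subgraph_iff_edges)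
    obtain u v where uv: "u \<in> V" "v \<in> V" "u \<noteq> v"
      using \<open>1 < card V\<close> assms(1) by (metis card_le_Suc0_iff_eq not_less One_nat_def)
    \<comment> \<open>A greatest graph would lie above both single-arc graphs on \<open>u\<close>
      and \<open>v\<close>, hence contain a 2-cycle.\<close>
    have "(u, v) \<in> directed G" "(v, u) \<in> directed G"
      using G(2)[OF single_arc_in_admgs[OF uv]] G(2)[OF single_arc_in_admgs[of v V u]] uv
      by (auto simp: subgraph_def)
    then have "(u, u) \<in> (directed G)\<^sup>+" by (meson trancl.simps)
    with G(1) show False by (auto simp: admgs_def acyclic_def)
  qed
  have covered: "covered L G H \<longleftrightarrow> subgraph G H \<and> num_edges H = num_edges G + 1"
    if "G \<in> admgs V" "H \<in> admgs V" for G H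
    using covered_iff[of G H] that by (simp add: car subgraph_iff_edges num_edges_eq_card[OF assms(1)])
  have "graded_by L num_edges"
    using empty num_edges_eq_card[OF assms(1)]
    by (intro graded_by_card[of empty_admg]) (simp_all add: car)
  with partial_order least no_greatest covered lower_semilattice lower_semimodular
  show ?thesis by (simp add: car)
qed

end
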